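(* Let $n\ge r\ge 1$ be integers and let $G=V^1\vee V^2\vee\cdots\vee V^r$ be a join digraph of order $n$, where each $V^i$ is a weakly connected acyclic digraph on $n_i$ vertices, $n_1\ge n_2\ge\cdots\ge n_r\ge 1$ and $\sum_{i=1}^r n_i=n$. Then: (i) If $r\mid n$, then $$LE(G)\leq\left(1+\frac{1}{3r^2}-\frac{1}{r}\right)n^3-\frac{1}{2r}n^2+\frac{1}{6}n,$$ with equality if and only if each $V^i$ is a transitive tournament with $n_i=\frac{n}{r}$. (ii) If $r\nmid n$, then $$LE(G)\leq n^3+\frac{1}{6}n+p-q,$$ where $p=\left\lceil\frac{n}{r}\right\rceil^2\left(n-r\left\lfloor\frac{n}{r}\right\rfloor\right)\left(\frac{1}{3}\left\lceil\frac{n}{r}\right\rceil-n-\frac{1}{2}\right)$ and $q=\left\lfloor\frac{n}{r}\right\rfloor^2\left(n-r\left\lceil\frac{n}{r}\right\rceil\right)\left(\frac{1}{3}\left\lfloor\frac{n}{r}\right\rfloor-n-\frac{1}{2}\right)$. Equality holds if and only if each $V^i$ is a transitive tournament, with $n_s=\left\lceil\frac{n}{r}\right\rceil$ for $s=1,2,\ldots,n-r\left\lfloor\frac{n}{r}\right\rfloor$ and $n_t=\left\lfloor\frac{n}{r}\right\rfloor$ for $t=n-r\left\lfloor\frac{n}{r}\right\rfloor+1,\ldots,r$.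
   Context: All digraphs are finite, have no loops or multiple arcs, and are weakly connected (standing assumption). For a digraph $G$ with vertex set $\{v_1,\dots,v_n\}$, $d_i^+$ is the outdegree of $v_i$, $A(G)$ is the adjacency matrix (entry $(i,j)$ is $1$ iff $(v_i,v_j)$ is an arc), $D^+(G)=\mathrm{diag}(d_1^+,\dots,d_n^+)$, and $L(G)=D^+(G)-A(G)$ is the Laplacian matrix. The Laplacian energy is $LE(G)=\sum_{i=1}^n\lambda_i^2$, where $\lambda_i$ are the eigenvalues of $L(G)$. A digraph is acyclic if it has no directed cycle. The join $G_1\vee G_2$ of vertex-disjoint digraphs has vertex set $\mathcal V(G_1)\cup\mathcal V(G_2)$ and arc set $\mathcal A(G_1)\cup\mathcal A(G_2)\cup\{(u,v),(v,u): u\in\mathcal V(G_1), v\in\mathcal V(G_2)\}$. A tournament is an orientation of a complete graph; it is transitive if $(u,v),(v,w)$ arcs imply $(u,w)$ is an arc. *)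

theory Defs
  imports
    "HOL-Library.Disjoint_Sets"
    "Graph_Theory.Digraph_Component"
    "Jordan_Normal_Form.Char_Poly"
begin

text \<open>
  A digraph is a \<open>'a pair_pre_digraph\<close> satisfying the locale predicate \<open>pair_digraph\<close>: finite,
  loop-free, and without multiple arcs because the arcs form a set of pairs.
  Weak connectivity is \<open>Digraph_Component.connected\<close>, i.e. strong connectivity of the
  symmetrised digraph; in particular the vertex set is nonempty.
\<close>

text \<open>
  The matrices are indexed by an enumeration \<open>v 0, \<dots>, v (n - 1)\<close> of the \<open>n\<close> vertices.
\<close>

definition adjacency_mat :: "(nat \<Rightarrow> 'a) \<Rightarrow> 'a pair_pre_digraph \<Rightarrow> real mat" where
  "adjacency_mat v G = Matrix.mat (card (pverts G)) (card (pverts G))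
     (\<lambda>(i, j). if (v i, v j) \<in> parcs G then 1 else 0)"

definition outdegree_mat :: "(nat \<Rightarrow> 'a) \<Rightarrow> 'a pair_pre_digraph \<Rightarrow> real mat" where
  "outdegree_mat v G = mat_diag (card (pverts G)) (\<lambda>i. real (out_degree (with_proj G) (v i)))"

definition laplacian_mat :: "(nat \<Rightarrow> 'a) \<Rightarrow> 'a pair_pre_digraph \<Rightarrow> real mat" where
  "laplacian_mat v G = outdegree_mat v G - adjacency_mat v G"

text \<open>
  The Laplacian of a digraph may have non-real eigenvalues, so the eigenvalues are the complex
  roots of the characteristic polynomial, with algebraic multiplicity.
\<close>

definition laplacian_eigenvalues :: "(nat \<Rightarrow> 'a) \<Rightarrow> 'a pair_pre_digraph \<Rightarrow> complex multiset" where
  "laplacian_eigenvalues v G = proots (char_poly (map_mat complex_of_real (laplacian_mat v G)))"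

text \<open>
  The sum of the squares of the eigenvalues is always real; the lemma
  \<open>of_real_laplacian_energy\<close> below shows that taking the real part loses nothing.
\<close>

definition laplacian_energy :: "(nat \<Rightarrow> 'a) \<Rightarrow> 'a pair_pre_digraph \<Rightarrow> real" where
  "laplacian_energy v G = Re (\<Sum>z\<in>#laplacian_eigenvalues v G. z\<^sup>2)"

lemma laplacian_mat_carrier:
  "laplacian_mat v G \<in> carrier_mat (card (pverts G)) (card (pverts G))"
  unfolding laplacian_mat_def adjacency_mat_def by (intro minus_carrier_mat) simp

lemma image_cnj_laplacian_eigenvalues:
  "image_mset cnj (laplacian_eigenvalues v G) = laplacian_eigenvalues v G"
proof -
  define A where "A = map_mat complex_of_real (laplacian_mat v G)"
  define p where "p = char_poly A"
  have A: "A \<in> carrier_mat (card (pverts G)) (card (pverts G))"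
    unfolding A_def using laplacian_mat_carrier[of v G] by simp
  interpret c: field_hom cnj by unfold_locales auto
  interpret cp: map_poly_inj_idom_divide_hom cnj ..
  have p0: "p \<noteq> 0"
    using degree_monic_char_poly[OF A] unfolding p_def by auto
  have "map_mat cnj A = A"
    unfolding A_def by (intro eq_matI) auto
  then have cp: "map_poly cnj p = p"
    using c.char_poly_hom[OF A] unfolding p_def by simp
  have ord: "Polynomial.order (cnj x) p = Polynomial.order x p" for x
    using cp.order_hom[of x p] cp by simp
  have "count (image_mset cnj (proots p)) x = count (proots p) x" for x
  proof -
    have "count (image_mset cnj M) (cnj y) = count M y" for M y
      by (induction M) auto
    from this[of "proots p" "cnj x"]
    have "count (image_mset cnj (proots p)) x = count (proots p) (cnj x)" by simp
    then show ?thesis using ord[of x] p0 by simp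
  qed
  then show ?thesis
    unfolding laplacian_eigenvalues_def A_def[symmetric] p_def[symmetric]
    by (intro multiset_eqI)
qed

lemma of_real_laplacian_energy:
  "complex_of_real (laplacian_energy v G) = (\<Sum>z\<in>#laplacian_eigenvalues v G. z\<^sup>2)"
proof -
  let ?M = "laplacian_eigenvalues v G"
  have "cnj (\<Sum>z\<in>#M. z\<^sup>2) = (\<Sum>z\<in>#image_mset cnj M. z\<^sup>2)" for M
    by (induction M) auto
  from this[of ?M] have "(\<Sum>z\<in>#?M. z\<^sup>2) \<in> \<real>"
    unfolding image_cnj_laplacian_eigenvalues by (simp add: Reals_cnj_iff)
  then show ?thesis
    unfolding laplacian_energy_def by simp
qed

definition acyclic_digraph :: "'a pair_pre_digraph \<Rightarrow> bool" where
  "acyclic_digraph G \<longleftrightarrow> (\<nexists>c. pre_digraph.cycle (with_proj G) c)"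

definition join_digraph :: "'a pair_pre_digraph \<Rightarrow> 'a pair_pre_digraph \<Rightarrow> 'a pair_pre_digraph" where
  "join_digraph G H = \<lparr> pverts = pverts G \<union> pverts H,
     parcs = parcs G \<union> parcs H \<union> pverts G \<times> pverts H \<union> pverts H \<times> pverts G \<rparr>"

text \<open>\<open>iterated_join V r\<close> is \<open>V 1 \<or> V 2 \<or> \<dots> \<or> V r\<close>; the empty digraph is neutral for the join.\<close>

primrec iterated_join :: "(nat \<Rightarrow> 'a pair_pre_digraph) \<Rightarrow> nat \<Rightarrow> 'a pair_pre_digraph" where
  "iterated_join V 0 = \<lparr> pverts = {}, parcs = {} \<rparr>"
| "iterated_join V (Suc k) = join_digraph (iterated_join V k) (V (Suc k))"

text \<open>Orientation of a complete graph: exactly one of the two possible arcs for each pair.\<close>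

definition tournament :: "'a pair_pre_digraph \<Rightarrow> bool" where
  "tournament G \<longleftrightarrow> pair_digraph G \<and>
     (\<forall>u\<in>pverts G. \<forall>w\<in>pverts G. u \<noteq> w \<longrightarrow> ((u, w) \<in> parcs G) \<noteq> ((w, u) \<in> parcs G))"

definition transitive_tournament :: "'a pair_pre_digraph \<Rightarrow> bool" where
  "transitive_tournament G \<longleftrightarrow> tournament G \<and> trans (parcs G)"

end

theory Submission
  imports Defs "Jordan_Normal_Form.Schur_Decomposition"
begin

text \<open>
  The energy is the trace of the squared Laplacian, i.e. the sum of the squared outdegrees plus the
  number of ordered pairs joined in both directions; the latter are exactly the pairs from
  different blocks. Inside an acyclic block with \<open>s\<close> vertices the outdegrees are dominated by
  \<open>0, \<dots>, s - 1\<close>, the sequence of a transitive tournament. The resulting sum over the block sizes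
  is, up to terms linear in \<open>s\<close>, that of \<open>s\<^sup>2 (s / 3 - n - 1 / 2)\<close>, which is strictly concave on
  \<open>0 \<le> s \<le> n\<close>. Comparing it with its chord through \<open>\<lfloor>n / r\<rfloor>\<close> and \<open>\<lfloor>n / r\<rfloor> + 1\<close> shows that the
  maximum is attained exactly at the balanced partition, for \<open>r\<close> dividing \<open>n\<close> or not.
\<close>

section \<open>Sum of squared eigenvalues as a trace\<close>

lemma trace_mult_comm:
  fixes A B :: "'a :: comm_semiring_0 mat"
  assumes "A \<in> carrier_mat n m" "B \<in> carrier_mat m n"
  shows "(\<Sum>i<n. (A * B) $$ (i, i)) = (\<Sum>j<m. (B * A) $$ (j, j))"
proof -
  have "(\<Sum>i<n. (A * B) $$ (i, i)) = (\<Sum>i<n. \<Sum>j<m. A $$ (i, j) * B $$ (j, i))"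
    using assms by (intro sum.cong) (auto simp: scalar_prod_def atLeast0LessThan)
  also have "\<dots> = (\<Sum>j<m. \<Sum>i<n. B $$ (j, i) * A $$ (i, j))"
    by (subst sum.swap) (simp add: mult.commute)
  also have "\<dots> = (\<Sum>j<m. (B * A) $$ (j, j))"
    using assms by (intro sum.cong) (auto simp: scalar_prod_def atLeast0LessThan)
  finally show ?thesis .
qed

lemma proots_prod_linear_factors:
  fixes xs :: "'a :: idom list"
  shows "proots (\<Prod>a\<leftarrow>xs. [:- a, 1:]) = mset xs"
proof (induction xs)
  case (Cons x xs)
  have "(\<Prod>a\<leftarrow>xs. [:- a, 1:]) \<noteq> 0" by (auto simp: prod_list_zero_iff)
  then have "proots ([:- x, 1:] * (\<Prod>a\<leftarrow>xs. [:- a, 1:])) = proots [:- x, 1:] + mset xs"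
    using Cons.IH by (subst proots_mult) auto
  then show ?case by simp
qed simp

text \<open>By Schur decomposition \<open>A\<close> is similar to an upper triangular
  \<open>B\<close> whose diagonal lists the eigenvalues with multiplicity. The diagonal of
  \<open>B * B\<close> consists of their squares, and the trace of the square is invariant under
  similarity.\<close>

lemma sum_proots_char_poly_square:
  fixes A :: "complex mat"
  assumes A: "A \<in> carrier_mat n n"
  shows "(\<Sum>z\<in>#proots (char_poly A). z\<^sup>2) = (\<Sum>i<n. \<Sum>j<n. A $$ (i, j) * A $$ (j, i))"
proof -
  obtain as where "char_poly A = (\<Prod>a\<leftarrow>as. [:- a, 1:])"
    using char_poly_factorized[OF A] by blast
  from schur_decomposition_exists[OF A this] obtain B where
    B: "B \<in> carrier_mat n n" and ut: "upper_triangular B" and sim: "similar_mat A B"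
    by blast
  obtain P Q where "similar_mat_wit A B P Q"
    using sim unfolding similar_mat_def by blast
  note w = similar_mat_witD2[OF A this]
  have "proots (char_poly A) = proots (\<Prod>a\<leftarrow>diag_mat B. [:- a, 1:])"
    using char_poly_similar[OF sim] char_poly_upper_triangular[OF B ut] by simp
  also have "\<dots> = mset (diag_mat B)"
    by (rule proots_prod_linear_factors)
  finally have "(\<Sum>z\<in>#proots (char_poly A). z\<^sup>2) = (\<Sum>i<n. (B $$ (i, i))\<^sup>2)"
    using B by (simp add: diag_mat_def o_def sum_mset_sum_list interv_sum_list_conv_sum_set_nat
        atLeast0LessThan flip: mset_map)
  also have "\<dots> = (\<Sum>i<n. (B * B) $$ (i, i))"
  proof (intro sum.cong refl)
    fix i assume i: "i \<in> {..<n}"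
    have "(B * B) $$ (i, i) = (\<Sum>j<n. B $$ (i, j) * B $$ (j, i))"
      using B i by (simp add: scalar_prod_def atLeast0LessThan)
    \<comment> \<open>For \<open>j \<noteq> i\<close> one of the two factors lies below the diagonal
      and vanishes.\<close>
    also have "\<dots> = (\<Sum>j<n. if j = i then (B $$ (i, i))\<^sup>2 else 0)"
    proof (intro sum.cong refl)
      fix j assume "j \<in> {..<n}"
      then show "B $$ (i, j) * B $$ (j, i) = (if j = i then (B $$ (i, i))\<^sup>2 else 0)"
        using upper_triangularD[OF ut, of i j] upper_triangularD[OF ut, of j i] B i
        by (cases i j rule: linorder_cases) (auto simp: power2_eq_square)
    qed
    finally show "(B $$ (i, i))\<^sup>2 = (B * B) $$ (i, i)" using i by simp
  qed
  \<comment> \<open>Inserting \<open>Q * P = 1\<close> prepares the cyclic shift of \<open>Q\<close>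
    to the right end, which turns \<open>B * B\<close> into its conjugate
    \<open>A * A\<close>.\<close>
  also have "\<dots> = (\<Sum>i<n. (Q * (P * (B * B))) $$ (i, i))"
  proof -
    have "Q * (P * (B * B)) = Q * P * (B * B)"
      using w(6,7) B by (intro assoc_mult_mat[symmetric]) auto
    then show ?thesis using w B by simp
  qed
  also have "\<dots> = (\<Sum>i<n. ((P * (B * B)) * Q) $$ (i, i))"
    using w by (intro trace_mult_comm) auto
  also have "P * (B * B) * Q = A * A"
  proof -
    have "A * A = P * B * (Q * P) * B * Q"
      unfolding w(3) using w(4-7) by (simp add: assoc_mult_mat[of _ n n _ n _ n])
    also have "\<dots> = P * (B * B) * Q"
      using w by (simp add: assoc_mult_mat[of _ n n _ n _ n])
    finally show ?thesis by simp
  qed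
  also have "(\<Sum>i<n. (A * A) $$ (i, i)) = (\<Sum>i<n. \<Sum>j<n. A $$ (i, j) * A $$ (j, i))"
    using A by (intro sum.cong) (auto simp: scalar_prod_def atLeast0LessThan)
  finally show ?thesis .
qed

section \<open>Laplacian energy in terms of outdegrees and bidirected pairs\<close>

text \<open>In the trace of the squared Laplacian, the product of entries \<open>(u, w)\<close> and
  \<open>(w, u)\<close> is the squared outdegree for \<open>u = w\<close>; otherwise it is 1 if both
  arcs exist and 0 if not. Reindexing along \<open>v\<close> removes the enumeration.\<close>

lemma laplacian_energy_eq_sum:
  assumes sub: "parcs G \<subseteq> pverts G \<times> pverts G" and loopfree: "\<And>u. (u, u) \<notin> parcs G"
    and v: "bij_betw v {..<card (pverts G)} (pverts G)"
  shows "laplacian_energy v G = (\<Sum>u\<in>pverts G. (real (card (parcs G `` {u})))\<^sup>2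
           + real (card {w. (u, w) \<in> parcs G \<and> (w, u) \<in> parcs G}))"
proof -
  define k where "k = card (pverts G)"
  define E where "E = parcs G"
  define V where "V = pverts G"
  define d where "d u = real (card (E `` {u}))" for u
  define L where "L u w = (if u = w then d u else 0) - (if (u, w) \<in> E then 1 else 0)" for u w
  have v': "bij_betw v {..<k} V" using v by (simp add: k_def V_def)
  have fin: "finite V" using bij_betw_finite[OF v'] by simp
  have deg: "real (out_degree (with_proj G) u) = d u" for u
  proof -
    have "out_arcs (with_proj G) u = Pair u ` (E `` {u})"
      by (auto simp: out_arcs_def E_def)
    then show ?thesis by (simp add: out_degree_def d_def card_image inj_on_def)
  qed
  have entry: "laplacian_mat v G $$ (i, j) = L (v i) (v j)" if "i < k" "j < k" for i j
  proof -
    have "v i = v j \<longleftrightarrow> i = j"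
      using bij_betw_imp_inj_on[OF v'] that by (auto simp: inj_on_def)
    then show ?thesis
      using that
      by (auto simp: laplacian_mat_def outdegree_mat_def adjacency_mat_def mat_diag_def deg
          L_def E_def k_def)
  qed
  have A: "map_mat complex_of_real (laplacian_mat v G) \<in> carrier_mat k k"
    using laplacian_mat_carrier[of v G] by (simp add: k_def)
  have "(\<Sum>z\<in>#laplacian_eigenvalues v G. z\<^sup>2)
      = (\<Sum>i<k. \<Sum>j<k. complex_of_real (laplacian_mat v G $$ (i, j) * laplacian_mat v G $$ (j, i)))"
    unfolding laplacian_eigenvalues_def sum_proots_char_poly_square[OF A] using A
    by (intro sum.cong refl) auto
  also have "\<dots> = complex_of_real (\<Sum>i<k. \<Sum>j<k. L (v i) (v j) * L (v j) (v i))"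
    by (simp add: entry)
  finally have "laplacian_energy v G = (\<Sum>i<k. \<Sum>j<k. L (v i) (v j) * L (v j) (v i))"
    unfolding laplacian_energy_def by simp
  also have "\<dots> = (\<Sum>i<k. \<Sum>w\<in>V. L (v i) w * L w (v i))"
    by (intro sum.cong refl sum.reindex_bij_betw[OF v'])
  also have "\<dots> = (\<Sum>u\<in>V. \<Sum>w\<in>V. L u w * L w u)"
    by (rule sum.reindex_bij_betw[OF v'])
  also have "\<dots> = (\<Sum>u\<in>V. (d u)\<^sup>2 + real (card {w. (u, w) \<in> E \<and> (w, u) \<in> E}))"
  proof (intro sum.cong refl)
    fix u assume u: "u \<in> V"
    have "(\<Sum>w\<in>V. L u w * L w u)
        = (\<Sum>w\<in>V. (if w = u then (d u)\<^sup>2 else 0) + of_bool ((u, w) \<in> E \<and> (w, u) \<in> E))"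
      using loopfree by (intro sum.cong refl) (auto simp: L_def E_def power2_eq_square)
    also have "\<dots> = (d u)\<^sup>2 + real (card (V \<inter> {w. (u, w) \<in> E \<and> (w, u) \<in> E}))"
      using fin u by (simp add: sum.distrib)
    also have "V \<inter> {w. (u, w) \<in> E \<and> (w, u) \<in> E} = {w. (u, w) \<in> E \<and> (w, u) \<in> E}"
      using sub by (auto simp: V_def E_def)
    finally show "(\<Sum>w\<in>V. L u w * L w u)
        = (d u)\<^sup>2 + real (card {w. (u, w) \<in> E \<and> (w, u) \<in> E})" .
  qed
  finally show ?thesis unfolding d_def E_def V_def .
qed

section \<open>Outdegrees in acyclic digraphs\<close>

text \<open>A nonempty closed walk contains a cycle. This passes from cycles as arc lists to the
  relational \<open>acyclic\<close>, the form used in the induction below.\<close>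

lemma acyclic_digraph_imp_acyclic:
  assumes "pair_digraph G" and "acyclic_digraph G"
  shows "acyclic (parcs G)"
proof -
  interpret pair_digraph G by fact
  show ?thesis
  proof (rule acyclicI, rule allI, rule notI)
    fix u assume "(u, u) \<in> (parcs G)\<^sup>+"
    then obtain p where "awalk u p u" "p \<noteq> []"
      using reachable1_awalk[of u u] by auto
    then have "closed_w p" unfolding closed_w_def by blast
    then show False
      using closed_w_imp_cycle assms(2) unfolding acyclic_digraph_def by blast
  qed
qed

text \<open>Removing a source leaves the other outdegrees unchanged, so induction applies.\<close>

lemma acyclic_outdegree_square_sum:
  fixes c :: real
  assumes "finite S" and "R \<subseteq> S \<times> S" and "acyclic R" and "0 \<le> c"
  shows "(\<Sum>u\<in>S. (c + real (card (R `` {u})))\<^sup>2) \<le> (\<Sum>k<card S. (c + real k)\<^sup>2) \<and>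
    ((\<Sum>u\<in>S. (c + real (card (R `` {u})))\<^sup>2) = (\<Sum>k<card S. (c + real k)\<^sup>2)
      \<longleftrightarrow> total_on S R \<and> trans R)"
  using assms(1-3)
proof (induction "card S" arbitrary: S R)
  case 0
  then show ?case by (auto simp: trans_def)
next
  case (Suc s)
  have "finite R" using Suc.prems by (meson finite_SigmaI finite_subset)
  \<comment> \<open>A minimal vertex of the well-founded relation is a source \<open>x\<close>;
    deleting it removes only arcs that leave \<open>x\<close>.\<close>
  then have "wf R" using Suc.prems by (simp add: finite_acyclic_wf)
  moreover obtain y where "y \<in> S" using Suc.hyps(2) by fastforce
  ultimately obtain x where x: "x \<in> S" and min: "\<And>y. (y, x) \<in> R \<Longrightarrow> y \<notin> S"
    by (metis wfE_min)
  then have src: "(y, x) \<notin> R" for y using Suc.prems(2) by blast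
  define R' where "R' = {(a, b) \<in> R. a \<noteq> x}"
  let ?S = "S - {x}"
  have card: "card ?S = s" using Suc.hyps(2) Suc.prems(1) x by simp
  have sub': "R' \<subseteq> ?S \<times> ?S" using Suc.prems(2) src by (auto simp: R'_def)
  have "acyclic R'" using Suc.prems(3) by (rule acyclic_subset) (auto simp: R'_def)
  note IH = Suc.hyps(1)[OF card[symmetric] _ sub' this]
  have img: "R' `` {u} = R `` {u}" if "u \<in> ?S" for u using that by (auto simp: R'_def)
  have split: "(\<Sum>u\<in>S. (c + real (card (R `` {u})))\<^sup>2)
      = (c + real (card (R `` {x})))\<^sup>2 + (\<Sum>u\<in>?S. (c + real (card (R' `` {u})))\<^sup>2)"
    using Suc.prems(1) x by (simp add: sum.remove[of S x] img)
  have out: "R `` {x} \<subseteq> ?S" using Suc.prems(2) src by auto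
  then have le: "card (R `` {x}) \<le> s"
    using card Suc.prems(1) card_mono[of ?S "R `` {x}"] by simp
  have full: "card (R `` {x}) = s \<longleftrightarrow> R `` {x} = ?S"
    using card Suc.prems(1) out card_subset_eq[of ?S "R `` {x}"] by auto
  have sq: "(c + real (card (R `` {x})))\<^sup>2 \<le> (c + real s)\<^sup>2"
    using le assms(4) by (intro power_mono) auto
  \<comment> \<open>Squaring is injective on nonnegative numbers, so equality forces the source to
    dominate every other vertex.\<close>
  have sq_eq: "(c + real (card (R `` {x})))\<^sup>2 = (c + real s)\<^sup>2 \<longleftrightarrow> R `` {x} = ?S"
    using assms(4) by (simp add: power2_eq_iff_nonneg flip: full)
  have "total_on S R \<and> trans R \<longleftrightarrow> R `` {x} = ?S \<and> total_on ?S R' \<and> trans R'"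
  proof
    assume *: "total_on S R \<and> trans R"
    have "R `` {x} = ?S" using * out x src unfolding total_on_def by blast
    moreover have "total_on ?S R'" using * unfolding total_on_def R'_def by auto
    moreover have "trans R'" using * unfolding trans_def R'_def by blast
    ultimately show "R `` {x} = ?S \<and> total_on ?S R' \<and> trans R'" by blast
  next
    assume *: "R `` {x} = ?S \<and> total_on ?S R' \<and> trans R'"
    have "total_on S R"
      using * unfolding total_on_def R'_def by blast
    \<comment> \<open>A path of length two from \<open>x\<close> ends in a vertex other than
      \<open>x\<close>, which \<open>x\<close> dominates. Any other such path avoids
      \<open>x\<close> altogether, as \<open>x\<close> is a source, and so lies in
      \<open>R'\<close>.\<close>
    moreover have "trans R"
    proof (rule transI)
      fix a b d assume ab: "(a, b) \<in> R" and bd: "(b, d) \<in> R"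
      show "(a, d) \<in> R"
      proof (cases "a = x")
        case True
        then show ?thesis using * bd Suc.prems(2) src by blast
      next
        case False
        moreover have "b \<noteq> x" using ab src by blast
        ultimately show ?thesis using * ab bd unfolding R'_def trans_def by blast
      qed
    qed
    ultimately show "total_on S R \<and> trans R" by blast
  qed
  moreover have "(\<Sum>k<card S. (c + real k)\<^sup>2) = (\<Sum>k<s. (c + real k)\<^sup>2) + (c + real s)\<^sup>2"
    using Suc.hyps(2)[symmetric] by simp
  ultimately show ?case
    using IH Suc.prems(1) sq sq_eq unfolding split card by (smt (verit) finite_Diff)
qed

text \<open>Acyclicity excludes opposite arcs, so having exactly one arc between two distinct
  vertices reduces to having at least one.\<close>

lemma transitive_tournament_iff:
  assumes "pair_digraph G" and "acyclic (parcs G)"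
  shows "transitive_tournament G \<longleftrightarrow> total_on (pverts G) (parcs G) \<and> trans (parcs G)"
proof -
  have "\<not> ((u, w) \<in> parcs G \<and> (w, u) \<in> parcs G)" for u w
    using assms(2) unfolding acyclic_def by (meson trancl.r_into_trancl trancl_into_trancl)
  then show ?thesis
    using assms(1) unfolding transitive_tournament_def tournament_def total_on_def by blast
qed

text \<open>In the application \<open>c\<close> is the number of vertices outside a block of size
  \<open>s\<close>, and the summands are the squared outdegrees of a transitive tournament placed in
  the join.\<close>

lemma sum_shifted_squares:
  fixes c :: real
  shows "(\<Sum>k<s. (c + real k)\<^sup>2) = real s * c\<^sup>2 + c * real s * (real s - 1)
    + (real s - 1) * real s * (2 * real s - 1) / 6"
  by (induction s) (auto simp: field_simps power2_eq_square)

section \<open>Vertices, arcs and energy of the iterated join\<close>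

lemma pverts_iterated_join: "pverts (iterated_join V r) = (\<Union>i\<in>{1..r}. pverts (V i))"
  by (induction r) (auto simp: join_digraph_def atLeastAtMostSuc_conv)

lemma parcs_iterated_join:
  "parcs (iterated_join V r) = (\<Union>i\<in>{1..r}. parcs (V i))
    \<union> (\<Union>i\<in>{1..r}. \<Union>j\<in>{1..r} - {i}. pverts (V i) \<times> pverts (V j))"
proof (induction r)
  case (Suc r)
  have "parcs (iterated_join V (Suc r)) = parcs (iterated_join V r) \<union> parcs (V (Suc r))
     \<union> (\<Union>i\<in>{1..r}. pverts (V i)) \<times> pverts (V (Suc r))
     \<union> pverts (V (Suc r)) \<times> (\<Union>i\<in>{1..r}. pverts (V i))"
    by (simp add: join_digraph_def pverts_iterated_join)
  moreover have "{1..Suc r} = insert (Suc r) {1..r}" by auto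
  moreover have "{1..r} - {Suc r} = {1..r}" by auto
  moreover have "insert (Suc r) {1..r} - {i} = insert (Suc r) ({1..r} - {i})"
    if "i \<in> {1..r}" for i using that by auto
  ultimately show ?case unfolding Suc.IH by auto
qed auto

text \<open>A vertex of block \<open>i\<close> is joined in both directions to every vertex outside
  the block. Inside, it keeps its own arcs, none of them bidirected since the block is
  acyclic.\<close>

lemma laplacian_energy_iterated_join:
  assumes dig: "\<And>i. i \<in> {1..r} \<Longrightarrow> pair_digraph (V i)"
    and acy: "\<And>i. i \<in> {1..r} \<Longrightarrow> acyclic (parcs (V i))"
    and disj: "disjoint_family_on (\<lambda>i. pverts (V i)) {1..r}"
    and n: "n = (\<Sum>i=1..r. card (pverts (V i)))"
    and v: "bij_betw v {..<n} (pverts (iterated_join V r))"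
  shows "laplacian_energy v (iterated_join V r) =
    (\<Sum>i=1..r. (\<Sum>u\<in>pverts (V i). (real n - real (card (pverts (V i)))
        + real (card (parcs (V i) `` {u})))\<^sup>2)
      + real (card (pverts (V i))) * (real n - real (card (pverts (V i)))))"
proof -
  let ?G = "iterated_join V r"
  let ?d = "\<lambda>i u. card (parcs (V i) `` {u})"
  let ?m = "\<lambda>i. card (pverts (V i))"
  have fin: "finite (pverts (V i))" if "i \<in> {1..r}" for i
    using dig[OF that] by (simp add: pair_digraph_def pair_fin_digraph_def pair_fin_digraph_axioms_def)
  have sub: "parcs (V i) \<subseteq> pverts (V i) \<times> pverts (V i)" if "i \<in> {1..r}" for i
  proof -
    interpret pair_digraph "V i" using dig that .
    show ?thesis using in_arcsD1 in_arcsD2 by auto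
  qed
  have finG: "finite (pverts ?G)" using fin by (auto simp: pverts_iterated_join)
  have cardG: "card (pverts ?G) = n" using bij_betw_same_card[OF v] by simp
  have "parcs ?G \<subseteq> pverts ?G \<times> pverts ?G"
    using sub unfolding pverts_iterated_join parcs_iterated_join by fastforce
  have same: "i = j" if "u \<in> pverts (V i)" "u \<in> pverts (V j)" "i \<in> {1..r}" "j \<in> {1..r}" for u i j
    using disj that unfolding disjoint_family_on_def by blast
  have asym: "(w, u) \<notin> parcs (V i)" if "(u, w) \<in> parcs (V i)" "i \<in> {1..r}" for u w i
    using acy that unfolding acyclic_def by (meson trancl.r_into_trancl trancl_into_trancl)
  have block: "k = i" if "(u, w) \<in> parcs (V k)" "u \<in> pverts (V i) \<or> w \<in> pverts (V i)"
      "k \<in> {1..r}" "i \<in> {1..r}" for u w k i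
    using that sub[of k] same[of _ k i] by blast
  \<comment> \<open>Once the block of \<open>u\<close> is fixed, an arc at \<open>u\<close>, in
    either direction, is an arc of that block or has an arbitrary outside vertex as its other end.
    Outdegrees and bidirected neighbours are read off from this.\<close>
  have arcs: "(u, w) \<in> parcs ?G \<longleftrightarrow> (u, w) \<in> parcs (V i) \<or> w \<in> pverts ?G - pverts (V i)"
      "(w, u) \<in> parcs ?G \<longleftrightarrow> (w, u) \<in> parcs (V i) \<or> w \<in> pverts ?G - pverts (V i)"
    if i: "i \<in> {1..r}" and u: "u \<in> pverts (V i)" for i u w
  proof -
    have mem: "(x, y) \<in> parcs ?G \<longleftrightarrow> (\<exists>k\<in>{1..r}. (x, y) \<in> parcs (V k))
        \<or> (\<exists>k\<in>{1..r}. \<exists>j\<in>{1..r}. j \<noteq> k \<and> x \<in> pverts (V k) \<and> y \<in> pverts (V j))" for x y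
      unfolding parcs_iterated_join by blast
    have out: "w \<in> pverts ?G - pverts (V i) \<longleftrightarrow> (\<exists>j\<in>{1..r}. j \<noteq> i \<and> w \<in> pverts (V j))"
    proof
      assume "w \<in> pverts ?G - pverts (V i)"
      then show "\<exists>j\<in>{1..r}. j \<noteq> i \<and> w \<in> pverts (V j)"
        unfolding pverts_iterated_join by (metis DiffE UN_E)
    next
      assume "\<exists>j\<in>{1..r}. j \<noteq> i \<and> w \<in> pverts (V j)"
      then obtain j where j: "j \<in> {1..r}" "j \<noteq> i" "w \<in> pverts (V j)" by blast
      then have "w \<notin> pverts (V i)" using same[OF j(3) _ j(1) i] by blast
      then show "w \<in> pverts ?G - pverts (V i)"
        unfolding pverts_iterated_join using j by blast
    qed
    have only: "u \<in> pverts (V k) \<longleftrightarrow> k = i" if "k \<in> {1..r}" for k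
      using same[OF _ u that i] u by blast
    have inner: "(\<exists>k\<in>{1..r}. (u, w) \<in> parcs (V k)) \<longleftrightarrow> (u, w) \<in> parcs (V i)"
        "(\<exists>k\<in>{1..r}. (w, u) \<in> parcs (V k)) \<longleftrightarrow> (w, u) \<in> parcs (V i)"
      using block[of u w _ i] block[of w u _ i] i u by blast+
    show "(u, w) \<in> parcs ?G \<longleftrightarrow> (u, w) \<in> parcs (V i) \<or> w \<in> pverts ?G - pverts (V i)"
      unfolding mem out inner using only i by metis
    show "(w, u) \<in> parcs ?G \<longleftrightarrow> (w, u) \<in> parcs (V i) \<or> w \<in> pverts ?G - pverts (V i)"
      unfolding mem out inner using only i by metis
  qed
  have loop: "(u, u) \<notin> parcs ?G" for u
  proof
    assume *: "(u, u) \<in> parcs ?G"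
    then have "u \<in> pverts ?G" using \<open>parcs ?G \<subseteq> _\<close> by blast
    then obtain i where "i \<in> {1..r}" "u \<in> pverts (V i)" unfolding pverts_iterated_join by blast
    then show False using * arcs(1) asym by blast
  qed
  have rest: "real (card (pverts ?G - pverts (V i))) = real n - real (?m i)" if "i \<in> {1..r}" for i
  proof -
    have "pverts (V i) \<subseteq> pverts ?G" using that unfolding pverts_iterated_join by blast
    then show ?thesis
      using finG fin[OF that] cardG by (simp add: card_Diff_subset of_nat_diff card_mono flip: cardG)
  qed
  have deg: "real (card (parcs ?G `` {u})) = real n - real (?m i) + real (?d i u)"
    if i: "i \<in> {1..r}" and u: "u \<in> pverts (V i)" for i u
  proof -
    have "parcs ?G `` {u} = parcs (V i) `` {u} \<union> (pverts ?G - pverts (V i))"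
      using arcs(1)[OF i u] by blast
    moreover have "parcs (V i) `` {u} \<subseteq> pverts (V i)" using sub[OF i] by blast
    ultimately have "card (parcs ?G `` {u}) = ?d i u + card (pverts ?G - pverts (V i))"
      using finG fin[OF i] by (auto intro!: card_Un_disjoint intro: finite_subset)
    then show ?thesis using rest[OF i] by simp
  qed
  have bidir: "real (card {w. (u, w) \<in> parcs ?G \<and> (w, u) \<in> parcs ?G}) = real n - real (?m i)"
    if i: "i \<in> {1..r}" and u: "u \<in> pverts (V i)" for i u
  proof -
    have "{w. (u, w) \<in> parcs ?G \<and> (w, u) \<in> parcs ?G} = pverts ?G - pverts (V i)"
      using arcs[OF i u] asym[OF _ i] sub[OF i] by auto
    then show ?thesis using rest[OF i] by simp
  qed
  have "laplacian_energy v ?G = (\<Sum>u\<in>pverts ?G. (real (card (parcs ?G `` {u})))\<^sup>2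
           + real (card {w. (u, w) \<in> parcs ?G \<and> (w, u) \<in> parcs ?G}))"
    using \<open>parcs ?G \<subseteq> _\<close> loop v by (intro laplacian_energy_eq_sum) (auto simp: cardG)
  also have "\<dots> = (\<Sum>i=1..r. \<Sum>u\<in>pverts (V i). (real (card (parcs ?G `` {u})))\<^sup>2
           + real (card {w. (u, w) \<in> parcs ?G \<and> (w, u) \<in> parcs ?G}))"
    unfolding pverts_iterated_join using fin same by (intro sum.UNION_disjoint) auto
  also have "\<dots> = (\<Sum>i=1..r. \<Sum>u\<in>pverts (V i). (real n - real (?m i) + real (?d i u))\<^sup>2
      + (real n - real (?m i)))"
    by (intro sum.cong refl) (simp add: deg bidir)
  finally show ?thesis by (simp add: sum.distrib)
qed

section \<open>Concave optimisation over the block sizes\<close>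

text \<open>
  What a transitive tournament on \<open>s\<close> vertices contributes to the energy of a join of order \<open>n\<close>,
  less the linear part \<open>(n\<^sup>2 + 1 / 6) * s\<close>.
\<close>

definition block_energy :: "nat \<Rightarrow> nat \<Rightarrow> real" where
  "block_energy n s = (real s)\<^sup>2 * (real s / 3 - real n - 1 / 2)"

text \<open>The difference to the chord through \<open>f\<close> and \<open>f + 1\<close> is a cubic whose third root exceeds \<open>n\<close>.\<close>

lemma block_energy_chord:
  assumes "s \<le> n" and "f \<le> n"
  defines "chord \<equiv> block_energy n f + (block_energy n (Suc f) - block_energy n f) * (real s - real f)"
  shows "block_energy n s \<le> chord" and "block_energy n s = chord \<longleftrightarrow> s = f \<or> s = Suc f"
proof -
  have diff: "chord - block_energy n s
      = ((real s - real f) * (real s - real f - 1)) * (3 * real n + 1 / 2 - 2 * real f - real s) / 3"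
    unfolding chord_def block_energy_def by (simp add: field_simps power2_eq_square)
  have pos: "3 * real n + 1 / 2 - 2 * real f - real s > 0" using assms by linarith
  \<comment> \<open>The factors are consecutive integers, so they never have strictly opposite
    signs. For real \<open>s\<close> between \<open>f\<close> and \<open>f + 1\<close> this would
    fail, hence the detour through \<open>int\<close>.\<close>
  have "(int s - int f) * (int s - int f - 1) \<ge> 0"
    by (cases "s \<le> f") (auto intro: mult_nonneg_nonneg mult_nonpos_nonpos)
  then have "real_of_int ((int s - int f) * (int s - int f - 1)) \<ge> 0" by linarith
  then have nonneg: "(real s - real f) * (real s - real f - 1) \<ge> 0" by simp
  show "block_energy n s \<le> chord"
    using divide_nonneg_pos[OF mult_nonneg_nonneg[OF nonneg less_imp_le[OF pos]], of 3]
    unfolding diff[symmetric] by simp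
  have "block_energy n s = chord \<longleftrightarrow> chord - block_energy n s = 0" by auto
  also have "\<dots> \<longleftrightarrow> s = f \<or> s = Suc f"
    unfolding diff using pos by auto
  finally show "block_energy n s = chord \<longleftrightarrow> s = f \<or> s = Suc f" .
qed

text \<open>The gaps \<open>g i - f i\<close> are nonnegative, so they sum to zero only if each
  vanishes. This carries the equality cases of the single blocks over to the whole join.\<close>

lemma sum_eq_iff_pointwise:
  fixes f g :: "'a \<Rightarrow> real"
  assumes "finite A" and "\<And>i. i \<in> A \<Longrightarrow> f i \<le> g i"
  shows "sum f A = sum g A \<longleftrightarrow> (\<forall>i\<in>A. f i = g i)"
proof -
  have "sum f A = sum g A \<longleftrightarrow> (\<Sum>i\<in>A. g i - f i) = 0" by (auto simp: sum_subtractf)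
  also have "\<dots> \<longleftrightarrow> (\<forall>i\<in>A. g i - f i = 0)" using assms by (intro sum_nonneg_eq_0_iff) auto
  finally show ?thesis by auto
qed

text \<open>Each block is bounded in two steps: by the transitive tournament of the same size, then
  by the chord at \<open>f\<close>. The chord is affine in the block size, so its sum over the
  blocks depends only on \<open>n\<close>, \<open>r\<close> and \<open>f\<close>; that sum is
  \<open>B\<close>. Equality has to hold in both steps for every block.\<close>

lemma laplacian_energy_iterated_join_le:
  assumes dig: "\<And>i. i \<in> {1..r} \<Longrightarrow> pair_digraph (V i)"
    and acy: "\<And>i. i \<in> {1..r} \<Longrightarrow> acyclic (parcs (V i))"
    and disj: "disjoint_family_on (\<lambda>i. pverts (V i)) {1..r}"
    and n: "n = (\<Sum>i=1..r. card (pverts (V i)))"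
    and v: "bij_betw v {..<n} (pverts (iterated_join V r))"
    and f: "f \<le> n"
  defines "B \<equiv> real n ^ 3 + real n / 6 + real r * block_energy n f
      + (block_energy n (Suc f) - block_energy n f) * (real n - real r * real f)"
  shows "laplacian_energy v (iterated_join V r) \<le> B"
    and "laplacian_energy v (iterated_join V r) = B \<longleftrightarrow>
      (\<forall>i\<in>{1..r}. transitive_tournament (V i) \<and> card (pverts (V i)) \<in> {f, Suc f})"
proof -
  define m where "m i = card (pverts (V i))" for i
  define lhs where "lhs i = (\<Sum>u\<in>pverts (V i). (real n - real (m i)
        + real (card (parcs (V i) `` {u})))\<^sup>2) + real (m i) * (real n - real (m i))" for i
  define mid where "mid i = (\<Sum>k<m i. (real n - real (m i) + real k)\<^sup>2)
      + real (m i) * (real n - real (m i))" for i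
  define rhs where "rhs i = ((real n)\<^sup>2 + 1 / 6) * real (m i) + block_energy n f
      + (block_energy n (Suc f) - block_energy n f) * (real (m i) - real f)" for i
  have le_n: "m i \<le> n" if "i \<in> {1..r}" for i
    unfolding n m_def using that by (intro member_le_sum) auto
  \<comment> \<open>The closed form of the shifted squares, plus the bidirected pairs, splits into a
    linear term and \<open>block_energy\<close>.\<close>
  have mid_eq: "mid i = ((real n)\<^sup>2 + 1 / 6) * real (m i) + block_energy n (m i)" for i
    unfolding mid_def sum_shifted_squares block_energy_def by (simp add: field_simps power2_eq_square)
  have step1: "lhs i \<le> mid i \<and> (lhs i = mid i \<longleftrightarrow> transitive_tournament (V i))"
    if i: "i \<in> {1..r}" for i
  proof -
    interpret pair_digraph "V i" using dig i .
    have "parcs (V i) \<subseteq> pverts (V i) \<times> pverts (V i)" using in_arcsD1 in_arcsD2 by auto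
    from acyclic_outdegree_square_sum[OF _ this acy[OF i], of "real n - real (m i)"]
    show ?thesis
      using le_n[OF i] transitive_tournament_iff[OF dig[OF i] acy[OF i]]
      by (simp add: lhs_def mid_def m_def)
  qed
  have step2: "mid i \<le> rhs i \<and> (mid i = rhs i \<longleftrightarrow> m i \<in> {f, Suc f})" if "i \<in> {1..r}" for i
    using block_energy_chord[OF le_n[OF that] f] by (auto simp: mid_eq rhs_def)
  have le: "lhs i \<le> rhs i" if "i \<in> {1..r}" for i using step1[OF that] step2[OF that] by linarith
  have eq: "lhs i = rhs i \<longleftrightarrow> transitive_tournament (V i) \<and> m i \<in> {f, Suc f}"
    if "i \<in> {1..r}" for i using step1[OF that] step2[OF that] by auto
  have energy: "laplacian_energy v (iterated_join V r) = sum lhs {1..r}"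
    unfolding lhs_def m_def using dig acy disj n v by (rule laplacian_energy_iterated_join)
  have sum_m: "(\<Sum>i=1..r. real (m i)) = real n" by (simp add: n m_def)
  \<comment> \<open>The linear terms add up to \<open>n ^ 3 + n / 6\<close> because the block sizes
    sum to \<open>n\<close>.\<close>
  have "sum rhs {1..r} = B"
    unfolding rhs_def B_def
    by (simp add: sum.distrib sum_subtractf sum_m power3_eq_cube power2_eq_square algebra_simps
        del: One_nat_def flip: sum_distrib_left sum_distrib_right sum_divide_distrib)
  then show "laplacian_energy v (iterated_join V r) \<le> B"
      "laplacian_energy v (iterated_join V r) = B \<longleftrightarrow>
        (\<forall>i\<in>{1..r}. transitive_tournament (V i) \<and> card (pverts (V i)) \<in> {f, Suc f})"
    using energy sum_mono[of "{1..r}" lhs rhs] le sum_eq_iff_pointwise[of "{1..r}" lhs rhs] eq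
    unfolding m_def by auto
qed

section \<open>Balanced block sizes and the two cases of the bound\<close>

text \<open>The sum forces exactly \<open>R\<close> indices to have the larger value, and
  monotonicity forces these to come first.\<close>

lemma antimono_two_values_iff:
  fixes m :: "nat \<Rightarrow> nat"
  assumes anti: "\<And>i j. 1 \<le> i \<Longrightarrow> i \<le> j \<Longrightarrow> j \<le> r \<Longrightarrow> m j \<le> m i"
    and sum: "(\<Sum>i=1..r. m i) = r * f + R" and R: "R \<le> r"
  shows "(\<forall>i\<in>{1..r}. m i \<in> {f, Suc f}) \<longleftrightarrow> (\<forall>i\<in>{1..r}. m i = (if i \<le> R then Suc f else f))"
proof
  assume two: "\<forall>i\<in>{1..r}. m i \<in> {f, Suc f}"
  define K where "K = {i\<in>{1..r}. m i = Suc f}"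
  have "(\<Sum>i=1..r. m i) = (\<Sum>i=1..r. f + of_bool (m i = Suc f))"
    using two by (intro sum.cong) auto
  also have "\<dots> = r * f + card K"
    by (simp add: sum.distrib K_def Int_def)
  finally have card: "card K = R" using sum by simp
  have "K \<subseteq> {1..R}"
  proof
    fix i assume i: "i \<in> K"
    \<comment> \<open>The set \<open>K\<close> is closed downwards: an earlier value is at least
      \<open>Suc f\<close>, hence equal to it. Thus \<open>i\<close> is at most
      \<open>card K = R\<close>.\<close>
    have "{1..i} \<subseteq> K"
    proof
      fix j assume j: "j \<in> {1..i}"
      then have "m i \<le> m j" using anti[of j i] i by (auto simp: K_def)
      then show "j \<in> K" using i j two unfolding K_def by force
    qed
    then have "card {1..i} \<le> card K" by (intro card_mono) (auto simp: K_def)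
    then show "i \<in> {1..R}" using i card by (auto simp: K_def)
  qed
  then have "K = {1..R}" using card by (intro card_subset_eq) auto
  then show "\<forall>i\<in>{1..r}. m i = (if i \<le> R then Suc f else f)"
    using two unfolding K_def by (auto simp: set_eq_iff)
qed auto

theorem theorem2p6:
  fixes n r :: nat
    and V :: "nat \<Rightarrow> 'a pair_pre_digraph"
    and m :: "nat \<Rightarrow> nat"
    and G :: "'a pair_pre_digraph"
    and v :: "nat \<Rightarrow> 'a"
  assumes "1 \<le> r" and "r \<le> n"
    and "\<And>i. i \<in> {1..r} \<Longrightarrow> pair_digraph (V i)"
    and "\<And>i. i \<in> {1..r} \<Longrightarrow> Digraph_Component.connected (with_proj (V i))"
    and "\<And>i. i \<in> {1..r} \<Longrightarrow> acyclic_digraph (V i)"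
    and "\<And>i. i \<in> {1..r} \<Longrightarrow> card (pverts (V i)) = m i"
    and "disjoint_family_on (\<lambda>i. pverts (V i)) {1..r}"
    and "\<And>i j. 1 \<le> i \<Longrightarrow> i \<le> j \<Longrightarrow> j \<le> r \<Longrightarrow> m i \<ge> m j"
    and "m r \<ge> 1"
    and "(\<Sum>i=1..r. m i) = n"
    and "G = iterated_join V r"
    and "bij_betw v {..<n} (pverts G)"
  shows
    "(r dvd n \<longrightarrow>
       (let B = (1 + 1 / (3 * real r ^ 2) - 1 / real r) * real n ^ 3
                  - 1 / (2 * real r) * real n ^ 2 + 1 / 6 * real n
        in laplacian_energy v G \<le> B \<and>
           (laplacian_energy v G = B \<longleftrightarrow>
              (\<forall>i\<in>{1..r}. transitive_tournament (V i) \<and> real (m i) = real n / real r)))) \<and>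
     (\<not> r dvd n \<longrightarrow>
       (let c = \<lceil>real n / real r\<rceil>;
            f = \<lfloor>real n / real r\<rfloor>;
            p = (real_of_int c)\<^sup>2 * (real n - real r * real_of_int f)
                  * (1 / 3 * real_of_int c - real n - 1 / 2);
            q = (real_of_int f)\<^sup>2 * (real n - real r * real_of_int c)
                  * (1 / 3 * real_of_int f - real n - 1 / 2);
            B = real n ^ 3 + 1 / 6 * real n + p - q
        in laplacian_energy v G \<le> B \<and>
           (laplacian_energy v G = B \<longleftrightarrow>
              (\<forall>i\<in>{1..r}. transitive_tournament (V i)) \<and>
              (\<forall>s. 1 \<le> s \<and> int s \<le> int n - int r * f \<longrightarrow> int (m s) = c) \<and>
              (\<forall>t. int n - int r * f + 1 \<le> int t \<and> t \<le> r \<longrightarrow> int (m t) = f))))"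
proof -
  \<comment> \<open>Quotient and remainder treat both cases at once: the sizes must be
    \<open>Suc f\<close> for the first \<open>R\<close> blocks and \<open>f\<close> for the others,
    and \<open>R = 0\<close> is the divisible case.\<close>
  define f where "f = n div r"
  define R where "R = n mod r"
  note dig = assms(3) and card = assms(6)
  have acy: "acyclic (parcs (V i))" if "i \<in> {1..r}" for i
    using acyclic_digraph_imp_acyclic assms(3,5) that by blast
  have n: "n = (\<Sum>i=1..r. card (pverts (V i)))"
    using assms(10) card by simp
  have nfR: "n = r * f + R" unfolding f_def R_def by simp
  have R: "R < r" using assms(1) unfolding R_def by simp
  have "f \<le> n" unfolding f_def by simp
  note bound = laplacian_energy_iterated_join_le[OF dig acy assms(7) n _ this]
  have v: "bij_betw v {..<n} (pverts (iterated_join V r))" using assms(11,12) by simp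
  define B where "B = real n ^ 3 + real n / 6 + real r * block_energy n f
      + (block_energy n (Suc f) - block_energy n f) * real R"
  have R_real: "real R = real n - real r * real f" using nfR by simp
  have le: "laplacian_energy v G \<le> B"
    using bound(1)[OF _ _ v] unfolding B_def R_real assms(11) by blast
  have "laplacian_energy v G = B \<longleftrightarrow>
      (\<forall>i\<in>{1..r}. transitive_tournament (V i) \<and> card (pverts (V i)) \<in> {f, Suc f})"
    using bound(2)[OF _ _ v] unfolding B_def R_real assms(11) by blast
  also have "\<dots> \<longleftrightarrow> (\<forall>i\<in>{1..r}. transitive_tournament (V i)) \<and> (\<forall>i\<in>{1..r}. m i \<in> {f, Suc f})"
    using card by auto
  also have "(\<forall>i\<in>{1..r}. m i \<in> {f, Suc f}) \<longleftrightarrow> (\<forall>i\<in>{1..r}. m i = (if i \<le> R then Suc f else f))"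
    using assms(8,10) nfR R by (intro antimono_two_values_iff) auto
  finally have eq: "laplacian_energy v G = B \<longleftrightarrow> (\<forall>i\<in>{1..r}. transitive_tournament (V i))
      \<and> (\<forall>i\<in>{1..r}. m i = (if i \<le> R then Suc f else f))" .
  have r0: "real r \<noteq> 0" using assms(1) by simp
  have floor: "\<lfloor>real n / real r\<rfloor> = int f"
    unfolding f_def by (rule floor_divide_of_nat_eq)
  show ?thesis
  proof (intro conjI impI)
    assume "r dvd n"
    then have "R = 0" unfolding R_def by simp
    then have nf: "real n = real r * real f" using nfR by simp
    \<comment> \<open>With \<open>R = 0\<close> only \<open>r\<close> times
      \<open>block_energy\<close> at \<open>f = n / r\<close> remains besides
      \<open>n ^ 3 + n / 6\<close>.\<close>
    have "B = (1 + 1 / (3 * real r ^ 2) - 1 / real r) * real n ^ 3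
        - 1 / (2 * real r) * real n ^ 2 + 1 / 6 * real n"
      unfolding B_def block_energy_def nf \<open>R = 0\<close> using r0
      by (simp add: field_simps power2_eq_square power3_eq_cube)
    moreover have "real (m i) = real n / real r \<longleftrightarrow> m i = f" for i
      unfolding nf using r0 by simp
    ultimately show "let B = (1 + 1 / (3 * real r ^ 2) - 1 / real r) * real n ^ 3
                  - 1 / (2 * real r) * real n ^ 2 + 1 / 6 * real n
        in laplacian_energy v G \<le> B \<and>
           (laplacian_energy v G = B \<longleftrightarrow>
              (\<forall>i\<in>{1..r}. transitive_tournament (V i) \<and> real (m i) = real n / real r))"
      using le eq \<open>R = 0\<close> unfolding Let_def by auto
  next
    assume "\<not> r dvd n"
    then have "R \<noteq> 0" unfolding R_def by (simp add: dvd_eq_mod_eq_0)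
    \<comment> \<open>A nonzero remainder places \<open>n / r\<close> strictly between
      \<open>f\<close> and \<open>f + 1\<close>, so the ceiling is \<open>Suc f\<close>.\<close>
    have "real f < real n / real r" "real n / real r < real f + 1"
      using r0 R \<open>R \<noteq> 0\<close> R_real by (auto simp: field_simps)
    then have ceil: "\<lceil>real n / real r\<rceil> = int (Suc f)"
      by (intro ceiling_unique) auto
    \<comment> \<open>Since \<open>n - r * f = R\<close> and \<open>n - r * Suc f = R - r\<close>,
      the last two terms are \<open>R\<close> times \<open>block_energy\<close> at
      \<open>Suc f\<close> plus \<open>r - R\<close> times \<open>block_energy\<close> at
      \<open>f\<close>, which is the sum of the chord values in \<open>B\<close>.\<close>
    have "B = real n ^ 3 + 1 / 6 * real n
        + (real_of_int (int (Suc f)))\<^sup>2 * (real n - real r * real_of_int (int f))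
            * (1 / 3 * real_of_int (int (Suc f)) - real n - 1 / 2)
        - (real_of_int (int f))\<^sup>2 * (real n - real r * real_of_int (int (Suc f)))
            * (1 / 3 * real_of_int (int f) - real n - 1 / 2)"
      unfolding B_def block_energy_def R_real by (simp add: field_simps power2_eq_square)
    moreover have "(\<forall>i\<in>{1..r}. m i = (if i \<le> R then Suc f else f)) \<longleftrightarrow>
        (\<forall>s. 1 \<le> s \<and> int s \<le> int n - int r * int f \<longrightarrow> int (m s) = int (Suc f)) \<and>
        (\<forall>t. int n - int r * int f + 1 \<le> int t \<and> t \<le> r \<longrightarrow> int (m t) = int f)"
    proof -
      have "int n - int r * int f = int R" using nfR by simp
      then show ?thesis using R by (auto simp: not_le)
    qed
    ultimately show "let c = \<lceil>real n / real r\<rceil>;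
            f = \<lfloor>real n / real r\<rfloor>;
            p = (real_of_int c)\<^sup>2 * (real n - real r * real_of_int f)
                  * (1 / 3 * real_of_int c - real n - 1 / 2);
            q = (real_of_int f)\<^sup>2 * (real n - real r * real_of_int c)
                  * (1 / 3 * real_of_int f - real n - 1 / 2);
            B = real n ^ 3 + 1 / 6 * real n + p - q
        in laplacian_energy v G \<le> B \<and>
           (laplacian_energy v G = B \<longleftrightarrow>
              (\<forall>i\<in>{1..r}. transitive_tournament (V i)) \<and>
              (\<forall>s. 1 \<le> s \<and> int s \<le> int n - int r * f \<longrightarrow> int (m s) = c) \<and>
              (\<forall>t. int n - int r * f + 1 \<le> int t \<and> t \<le> r \<longrightarrow> int (m t) = f))"
      using le eq unfolding Let_def floor ceil by simp
  qed
qed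

end
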